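(* Let $R$ be a subring of $\mathbb{Q}$, let $d_1,\dots,d_m$ be positive integers, and let $\mathfrak{c}\colon\Delta^{m-1}\to\mathbb{N}$, $\sigma\mapsto\mathfrak{c}_\sigma$, satisfy 1) $\mathfrak{c}_\emptyset=\mathfrak{c}_{\{i\}}=1$ for $1\le i\le m$; 2) if $\sigma=\sigma'\cup\sigma''$ and $\sigma'\cap\sigma''=\emptyset$, then $\mathfrak{c}_{\sigma'}\mathfrak{c}_{\sigma''}\mid\mathfrak{c}_\sigma$. Then there is a coefficient sequence $\mathfrak{c}'$ (with respect to $R$) such that $A(\mathfrak{c})\cong A(\mathfrak{c}')$.
   Context: $\mathbb{N}=\{1,2,\dots\}$; $\Delta^{m-1}$ is the set of all subsets of $[m]=\{1,\dots,m\}$, including $\emptyset$. A coefficient sequence (of length $m$, with respect to $R$) is a map $\mathfrak{c}\colon\Delta^{m-1}\to\mathbb{N}$ satisfying conditions 1) and 2) of the claim and 3) $\mathfrak{c}_\sigma$ is coprime to every prime $p$ that is invertible in $R$. For $\mathfrak{c}$ satisfying 1) and 2), $A(\mathfrak{c})$ is the graded commutative $R$-algebra with underlying free graded $R$-module $\bigoplus_{\sigma\subseteq[m]}R\langle a_\sigma\rangle$, $|a_\sigma|=\sum_{i\in\sigma}d_i$, unit $a_\emptyset$, and multiplication determined by $\prod_{i\in\sigma}a_{\{i\}}=\mathfrak{c}_\sigma a_\sigma$ (product in increasing order of $i$) together with $a_{\{i\}}^2=0$. The isomorphism is one of graded $R$-algebras. *)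

theory Defs
  imports "HOL-Algebra.Subrings" "HOL-Algebra.Module" "HOL-Computational_Algebra.Primes"
begin

section \<open>Subrings of the rationals\<close>

definition rat_ring :: "rat ring" where
  "rat_ring = \<lparr>carrier = UNIV, monoid.mult = (*), one = 1, zero = 0, add = (+)\<rparr>"

abbreviation (input) ring_of :: "rat set \<Rightarrow> rat ring" where
  "ring_of R \<equiv> rat_ring\<lparr>carrier := R\<rparr>"


section \<open>Coefficient sequences\<close>

text \<open>Functions on the simplex are represented by functions on all of \<open>nat set\<close>, of which
  only the values on subsets of \<open>{1..m}\<close> matter.\<close>

definition divisible_coeffs :: "nat \<Rightarrow> (nat set \<Rightarrow> nat) \<Rightarrow> bool" where
  "divisible_coeffs m c \<longleftrightarrow>
     (\<forall>\<sigma>. \<sigma> \<subseteq> {1..m} \<longrightarrow> 1 \<le> c \<sigma>) \<and>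
     c {} = 1 \<and> (\<forall>i\<in>{1..m}. c {i} = 1) \<and>
     (\<forall>\<sigma> \<sigma>' \<sigma>''. \<sigma> \<subseteq> {1..m} \<and> \<sigma> = \<sigma>' \<union> \<sigma>'' \<and> \<sigma>' \<inter> \<sigma>'' = {} \<longrightarrow> c \<sigma>' * c \<sigma>'' dvd c \<sigma>)"

definition coefficient_sequence :: "rat set \<Rightarrow> nat \<Rightarrow> (nat set \<Rightarrow> nat) \<Rightarrow> bool" where
  "coefficient_sequence R m c \<longleftrightarrow>
     divisible_coeffs m c \<and>
     (\<forall>\<sigma> p. \<sigma> \<subseteq> {1..m} \<and> Factorial_Ring.prime (p::nat) \<and> of_nat p \<in> Units (ring_of R)
        \<longrightarrow> coprime (c \<sigma>) p)"


section \<open>The graded algebra of a coefficient sequence\<close>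

text \<open>An element \<open>\<Sum>\<^sub>\<sigma> r\<^sub>\<sigma> a\<^sub>\<sigma>\<close> is the function \<open>\<sigma> \<mapsto> r\<^sub>\<sigma>\<close>, zero off the subsets of \<open>{1..m}\<close>.\<close>

definition gen :: "nat set \<Rightarrow> nat set \<Rightarrow> rat" where
  "gen \<sigma> = (\<lambda>\<rho>. if \<rho> = \<sigma> then 1 else 0)"

text \<open>The sign by which the product of the degree \<open>d i\<close> generators over \<open>\<sigma>\<close>, followed by that
  over \<open>\<tau>\<close>, differs from the increasing product over \<open>\<sigma> \<union> \<tau>\<close> (for disjoint \<open>\<sigma>\<close>, \<open>\<tau>\<close>).\<close>

definition koszul_sign :: "(nat \<Rightarrow> nat) \<Rightarrow> nat set \<Rightarrow> nat set \<Rightarrow> rat" where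
  "koszul_sign d \<sigma> \<tau> = (\<Prod>i\<in>\<sigma>. \<Prod>j\<in>{j\<in>\<tau>. j < i}. (-1) ^ (d i * d j))"

text \<open>The relations \<open>\<Prod>\<^sub>i\<^sub>\<in>\<^sub>\<sigma> a\<^sub>i = c\<^sub>\<sigma> a\<^sub>\<sigma>\<close> and \<open>a\<^sub>i\<^sup>2 = 0\<close> force, for disjoint \<open>\<sigma>\<close> and \<open>\<tau>\<close>,
  \<open>a\<^sub>\<sigma> a\<^sub>\<tau> = \<plusminus> (c\<^bsub>\<sigma>\<union>\<tau>\<^esub> / (c\<^sub>\<sigma> c\<^sub>\<tau>)) a\<^bsub>\<sigma>\<union>\<tau>\<^esub>\<close> with the sign above, and \<open>a\<^sub>\<sigma> a\<^sub>\<tau> = 0\<close> otherwise. The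
  definition extends this bilinearly; theorems \<open>coeff_data.coeff_algebra_presents\<close> and
  \<open>coeff_data.coeff_algebra_unique\<close> show that this is the one multiplication on the free module
  that makes it a graded commutative algebra with these relations.\<close>

definition coeff_algebra ::
  "rat set \<Rightarrow> nat \<Rightarrow> (nat \<Rightarrow> nat) \<Rightarrow> (nat set \<Rightarrow> nat) \<Rightarrow> (rat, nat set \<Rightarrow> rat) module" where
  "coeff_algebra R m d c =
     \<lparr>carrier = {x. (\<forall>\<sigma>. x \<sigma> \<in> R) \<and> (\<forall>\<sigma>. x \<sigma> \<noteq> 0 \<longrightarrow> \<sigma> \<subseteq> {1..m})},
      monoid.mult = (\<lambda>x y \<rho>. \<Sum>\<sigma>\<in>Pow \<rho>.
         koszul_sign d \<sigma> (\<rho> - \<sigma>) * (of_nat (c \<rho>) / (of_nat (c \<sigma>) * of_nat (c (\<rho> - \<sigma>))))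
           * (x \<sigma> * y (\<rho> - \<sigma>))),
      one = gen {},
      zero = (\<lambda>_. 0),
      add = (\<lambda>x y \<sigma>. x \<sigma> + y \<sigma>),
      smult = (\<lambda>r x \<sigma>. r * x \<sigma>)\<rparr>"

definition coeff_piece ::
  "rat set \<Rightarrow> nat \<Rightarrow> (nat \<Rightarrow> nat) \<Rightarrow> nat \<Rightarrow> (nat set \<Rightarrow> rat) set" where
  "coeff_piece R m d n =
     {x. (\<forall>\<sigma>. x \<sigma> \<in> R) \<and> (\<forall>\<sigma>. x \<sigma> \<noteq> 0 \<longrightarrow> \<sigma> \<subseteq> {1..m} \<and> (\<Sum>i\<in>\<sigma>. d i) = n)}"

definition graded_algebra_iso ::
  "('r, 'x) ring_scheme \<Rightarrow> ('r, 'a) module \<Rightarrow> (nat \<Rightarrow> 'a set) \<Rightarrow>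
   ('r, 'b) module \<Rightarrow> (nat \<Rightarrow> 'b set) \<Rightarrow> bool" where
  "graded_algebra_iso K A G B H \<longleftrightarrow>
     (\<exists>h \<in> ring_iso A B.
        (\<forall>r\<in>carrier K. \<forall>x\<in>carrier A. h (r \<odot>\<^bsub>A\<^esub> x) = r \<odot>\<^bsub>B\<^esub> h x) \<and>
        (\<forall>n. h ` G n = H n))"


section \<open>The defining property of the algebra\<close>

definition presents ::
  "rat set \<Rightarrow> nat \<Rightarrow> (nat \<Rightarrow> nat) \<Rightarrow> (nat set \<Rightarrow> nat) \<Rightarrow>
   (rat, nat set \<Rightarrow> rat) module \<Rightarrow> bool" where
  "presents R m d c M \<longleftrightarrow>
     module (ring_of R) M \<and> ring M \<and>
     (\<forall>r\<in>R. \<forall>x\<in>carrier M. \<forall>y\<in>carrier M.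
        (r \<odot>\<^bsub>M\<^esub> x) \<otimes>\<^bsub>M\<^esub> y = r \<odot>\<^bsub>M\<^esub> (x \<otimes>\<^bsub>M\<^esub> y) \<and> x \<otimes>\<^bsub>M\<^esub> (r \<odot>\<^bsub>M\<^esub> y) = r \<odot>\<^bsub>M\<^esub> (x \<otimes>\<^bsub>M\<^esub> y)) \<and>
     \<one>\<^bsub>M\<^esub> \<in> coeff_piece R m d 0 \<and>
     (\<forall>p q. \<forall>x\<in>coeff_piece R m d p. \<forall>y\<in>coeff_piece R m d q.
        x \<otimes>\<^bsub>M\<^esub> y \<in> coeff_piece R m d (p + q) \<and>
        x \<otimes>\<^bsub>M\<^esub> y = (-1) ^ (p * q) \<odot>\<^bsub>M\<^esub> (y \<otimes>\<^bsub>M\<^esub> x)) \<and>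
     (\<forall>\<sigma>. \<sigma> \<subseteq> {1..m} \<longrightarrow>
        foldr (\<lambda>i x. gen {i} \<otimes>\<^bsub>M\<^esub> x) (sorted_list_of_set \<sigma>) \<one>\<^bsub>M\<^esub> = of_nat (c \<sigma>) \<odot>\<^bsub>M\<^esub> gen \<sigma>) \<and>
     (\<forall>i\<in>{1..m}. gen {i} \<otimes>\<^bsub>M\<^esub> gen {i} = \<zero>\<^bsub>M\<^esub>)"

lemma cring_rat_ring: "cring rat_ring"
proof (rule cringI)
  show "abelian_group rat_ring"
  proof (rule abelian_groupI)
    fix x assume "x \<in> carrier rat_ring"
    show "\<exists>y\<in>carrier rat_ring. y \<oplus>\<^bsub>rat_ring\<^esub> x = \<zero>\<^bsub>rat_ring\<^esub>"
      by (rule bexI[of _ "- x"]) (auto simp: rat_ring_def)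
  qed (auto simp: rat_ring_def)
  show "comm_monoid rat_ring"
    by (rule comm_monoidI) (auto simp: rat_ring_def)
qed (auto simp: rat_ring_def algebra_simps)

lemma subring_rat_closed:
  assumes "subring R rat_ring"
  shows "0 \<in> R" "1 \<in> R" "\<And>x y. x \<in> R \<Longrightarrow> y \<in> R \<Longrightarrow> x + y \<in> R"
    "\<And>x y. x \<in> R \<Longrightarrow> y \<in> R \<Longrightarrow> x * y \<in> R" "\<And>x. x \<in> R \<Longrightarrow> - x \<in> R"
proof -
  note E = subringE[OF assms]
  show "0 \<in> R" "1 \<in> R" using E(2,3) by (auto simp: rat_ring_def)
  show "\<And>x y. x \<in> R \<Longrightarrow> y \<in> R \<Longrightarrow> x + y \<in> R" "\<And>x y. x \<in> R \<Longrightarrow> y \<in> R \<Longrightarrow> x * y \<in> R"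
    using E(6,7) by (auto simp: rat_ring_def)
  fix x assume x: "x \<in> R"
  interpret cring rat_ring by (rule cring_rat_ring)
  have "\<ominus>\<^bsub>rat_ring\<^esub> x \<oplus>\<^bsub>rat_ring\<^esub> x = \<zero>\<^bsub>rat_ring\<^esub>"
    by (rule l_neg) (simp add: rat_ring_def)
  then have "\<ominus>\<^bsub>rat_ring\<^esub> x = - x"
    by (simp add: rat_ring_def eq_neg_iff_add_eq_0)
  with E(5)[OF x] show "- x \<in> R" by simp
qed

lemma cring_ring_of:
  assumes "subring R rat_ring" shows "cring (ring_of R)"
  using cring_rat_ring assms
  by (metis cring.subcringI' ring.subcring_iff cring.axioms(1) subringE(1))

locale coeff_data =
  fixes R :: "rat set" and m :: nat and d :: "nat \<Rightarrow> nat" and c :: "nat set \<Rightarrow> nat"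
  assumes R: "subring R rat_ring" and c: "divisible_coeffs m c"
begin

context
  notes One_nat_def [simp del]
begin

lemmas RC = subring_rat_closed[OF R]

abbreviation "A \<equiv> coeff_algebra R m d c"

definition str :: "nat set \<Rightarrow> nat set \<Rightarrow> rat" where
  "str \<sigma> \<tau> = koszul_sign d \<sigma> \<tau> * (of_nat (c (\<sigma> \<union> \<tau>)) / (of_nat (c \<sigma>) * of_nat (c \<tau>)))"

lemma c_pos: "\<sigma> \<subseteq> {1..m} \<Longrightarrow> c \<sigma> > 0"
  using c by (auto simp: divisible_coeffs_def Suc_le_eq)

lemma c_empty [simp]: "c {} = 1" and c_single: "i \<in> {1..m} \<Longrightarrow> c {i} = 1"
  using c by (auto simp: divisible_coeffs_def)

lemma c_dvd: "\<sigma> \<union> \<tau> \<subseteq> {1..m} \<Longrightarrow> \<sigma> \<inter> \<tau> = {} \<Longrightarrow> c \<sigma> * c \<tau> dvd c (\<sigma> \<union> \<tau>)"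
  using c unfolding divisible_coeffs_def by blast

lemma carrier_A: "carrier A = {x. (\<forall>\<sigma>. x \<sigma> \<in> R) \<and> (\<forall>\<sigma>. x \<sigma> \<noteq> 0 \<longrightarrow> \<sigma> \<subseteq> {1..m})}"
  and one_A: "\<one>\<^bsub>A\<^esub> = gen {}" and zero_A: "\<zero>\<^bsub>A\<^esub> = (\<lambda>_. 0)"
  and add_A: "x \<oplus>\<^bsub>A\<^esub> y = (\<lambda>\<sigma>. x \<sigma> + y \<sigma>)" and smult_A: "r \<odot>\<^bsub>A\<^esub> x = (\<lambda>\<sigma>. r * x \<sigma>)"
  by (auto simp: coeff_algebra_def)

lemma mult_A: "(x \<otimes>\<^bsub>A\<^esub> y) \<rho> = (\<Sum>\<sigma>\<in>Pow \<rho>. str \<sigma> (\<rho> - \<sigma>) * (x \<sigma> * y (\<rho> - \<sigma>)))"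
  unfolding coeff_algebra_def str_def by (auto intro!: sum.cong simp: Un_absorb1)

lemma R_sum: "(\<And>i. i \<in> I \<Longrightarrow> f i \<in> R) \<Longrightarrow> sum f I \<in> R"
  by (induction I rule: infinite_finite_induct) (auto intro: RC)

lemma R_of_nat: "of_nat n \<in> R"
  by (induction n) (auto intro: RC)

lemma sign_cases: "koszul_sign d \<sigma> \<tau> = 1 \<or> koszul_sign d \<sigma> \<tau> = -1"
proof -
  have pm: "prod f I = 1 \<or> prod f I = -1"
    if "\<And>i. i \<in> I \<Longrightarrow> f i = 1 \<or> f i = -1" for I :: "nat set" and f :: "nat \<Rightarrow> rat"
    using that by (induction I rule: infinite_finite_induct) fastforce+
  show ?thesis
    unfolding koszul_sign_def by (intro pm) (simp add: minus_one_power_iff)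
qed

lemma R_str:
  assumes "\<sigma> \<union> \<tau> \<subseteq> {1..m}" "\<sigma> \<inter> \<tau> = {}" shows "str \<sigma> \<tau> \<in> R"
proof -
  from c_dvd[OF assms] obtain k where k: "c (\<sigma> \<union> \<tau>) = c \<sigma> * c \<tau> * k" by blast
  have "of_nat (c (\<sigma> \<union> \<tau>)) / (of_nat (c \<sigma>) * of_nat (c \<tau>)) = (of_nat k :: rat)"
    using c_pos[of \<sigma>] c_pos[of \<tau>] assms by (simp add: k)
  then show ?thesis
    using sign_cases[of \<sigma> \<tau>] R_of_nat[of k] by (auto simp: str_def intro: RC)
qed

lemma sign_Un_left:
  assumes "finite \<sigma>" "finite \<tau>" "\<sigma> \<inter> \<tau> = {}"
  shows "koszul_sign d (\<sigma> \<union> \<tau>) \<upsilon> = koszul_sign d \<sigma> \<upsilon> * koszul_sign d \<tau> \<upsilon>"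
  using assms by (simp add: koszul_sign_def prod.union_disjoint)

lemma sign_Un_right:
  assumes "finite \<tau>" "finite \<upsilon>" "\<tau> \<inter> \<upsilon> = {}"
  shows "koszul_sign d \<sigma> (\<tau> \<union> \<upsilon>) = koszul_sign d \<sigma> \<tau> * koszul_sign d \<sigma> \<upsilon>"
proof -
  have "{j \<in> \<tau> \<union> \<upsilon>. j < i} = {j \<in> \<tau>. j < i} \<union> {j \<in> \<upsilon>. j < i}" for i by auto
  then have "(\<Prod>j\<in>{j\<in>\<tau> \<union> \<upsilon>. j < i}. (-1::rat) ^ (d i * d j)) =
     (\<Prod>j\<in>{j\<in>\<tau>. j < i}. (-1) ^ (d i * d j)) * (\<Prod>j\<in>{j\<in>\<upsilon>. j < i}. (-1) ^ (d i * d j))" for i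
    using assms by (simp only:, subst prod.union_disjoint) auto
  then show ?thesis
    by (simp add: koszul_sign_def prod.distrib)
qed

lemma sign_empty [simp]: "koszul_sign d {} \<tau> = 1" "koszul_sign d \<sigma> {} = 1"
  by (auto simp: koszul_sign_def)

lemma sign_increasing: "(\<And>i j. i \<in> \<sigma> \<Longrightarrow> j \<in> \<tau> \<Longrightarrow> i < j) \<Longrightarrow> koszul_sign d \<sigma> \<tau> = 1"
proof -
  assume *: "\<And>i j. i \<in> \<sigma> \<Longrightarrow> j \<in> \<tau> \<Longrightarrow> i < j"
  have "{j\<in>\<tau>. j < i} = {}" if "i \<in> \<sigma>" for i using *[OF that] by force
  then show ?thesis unfolding koszul_sign_def by (simp only: prod.empty prod.neutral_const cong: prod.cong)
qed

lemma sign_single: "koszul_sign d {i} {j} = (if j < i then (-1) ^ (d i * d j) else 1)"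
proof -
  have "{k \<in> {j}. k < i} = (if j < i then {j} else {})" by auto
  then show ?thesis by (simp add: koszul_sign_def)
qed

lemma sign_swap_single:
  assumes "finite \<tau>" "i \<notin> \<tau>"
  shows "koszul_sign d {i} \<tau> = (-1) ^ (d i * sum d \<tau>) * koszul_sign d \<tau> {i}"
  using assms
proof (induction \<tau>)
  case (insert j \<tau>)
  have "koszul_sign d {i} (insert j \<tau>) = koszul_sign d {i} {j} * koszul_sign d {i} \<tau>"
    "koszul_sign d (insert j \<tau>) {i} = koszul_sign d {j} {i} * koszul_sign d \<tau> {i}"
    using insert sign_Un_right[of "{j}" \<tau> "{i}"] sign_Un_left[of "{j}" \<tau> "{i}"] by auto
  moreover have "koszul_sign d {i} {j} = (-1) ^ (d i * d j) * koszul_sign d {j} {i}"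
    using insert by (auto simp: sign_single mult.commute simp flip: power_mult_distrib)
  ultimately show ?case
    using insert by (simp add: algebra_simps power_add)
qed simp

lemma sign_swap:
  assumes "finite \<sigma>" "finite \<tau>" "\<sigma> \<inter> \<tau> = {}"
  shows "koszul_sign d \<sigma> \<tau> = (-1) ^ (sum d \<sigma> * sum d \<tau>) * koszul_sign d \<tau> \<sigma>"
  using assms
proof (induction \<sigma>)
  case (insert i \<sigma>)
  have "koszul_sign d (insert i \<sigma>) \<tau> = koszul_sign d {i} \<tau> * koszul_sign d \<sigma> \<tau>"
    "koszul_sign d \<tau> (insert i \<sigma>) = koszul_sign d \<tau> {i} * koszul_sign d \<tau> \<sigma>"
    using insert sign_Un_right[of "{i}" \<sigma> \<tau>] sign_Un_left[of "{i}" \<sigma> \<tau>] by auto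
  then show ?case
    using insert sign_swap_single[of \<tau> i] by (simp add: algebra_simps power_add)
qed simp

lemma str_assoc:
  assumes "\<sigma> \<union> \<tau> \<union> \<upsilon> \<subseteq> {1..m}" "\<sigma> \<inter> \<tau> = {}" "\<sigma> \<inter> \<upsilon> = {}" "\<tau> \<inter> \<upsilon> = {}"
  shows "str (\<sigma> \<union> \<tau>) \<upsilon> * str \<sigma> \<tau> = str \<sigma> (\<tau> \<union> \<upsilon>) * str \<tau> \<upsilon>"
proof -
  have fin: "finite \<sigma>" "finite \<tau>" "finite \<upsilon>"
    using assms(1) finite_subset[OF _ finite_atLeastAtMost] by auto
  have pos: "c (\<sigma> \<union> \<tau>) > 0" "c (\<tau> \<union> \<upsilon>) > 0"
    using assms(1) by (auto intro: c_pos)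
  show ?thesis
    using assms fin pos
    by (simp add: str_def sign_Un_left sign_Un_right Un_assoc mult_ac)
qed

lemma in_carrier:
  "x \<in> carrier A \<Longrightarrow> x \<sigma> \<in> R" "x \<in> carrier A \<Longrightarrow> \<not> \<sigma> \<subseteq> {1..m} \<Longrightarrow> x \<sigma> = 0"
  by (auto simp: carrier_A)

lemma mult_outside:
  assumes "x \<in> carrier A" "y \<in> carrier A" "\<not> \<rho> \<subseteq> {1..m}" shows "(x \<otimes>\<^bsub>A\<^esub> y) \<rho> = 0"
proof -
  have "x \<sigma> * y (\<rho> - \<sigma>) = 0" if "\<sigma> \<in> Pow \<rho>" for \<sigma>
  proof -
    have "\<not> \<sigma> \<subseteq> {1..m} \<or> \<not> \<rho> - \<sigma> \<subseteq> {1..m}" using assms(3) by blast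
    then show ?thesis
      using in_carrier(2)[OF assms(1), of \<sigma>] in_carrier(2)[OF assms(2), of "\<rho> - \<sigma>"] by auto
  qed
  then show ?thesis unfolding mult_A by (intro sum.neutral) simp
qed

lemma mult_closed:
  assumes "x \<in> carrier A" "y \<in> carrier A" shows "x \<otimes>\<^bsub>A\<^esub> y \<in> carrier A"
proof -
  have "(x \<otimes>\<^bsub>A\<^esub> y) \<rho> \<in> R" for \<rho>
  proof (cases "\<rho> \<subseteq> {1..m}")
    case True
    show ?thesis unfolding mult_A
      by (intro R_sum RC(4) R_str in_carrier assms) (use True in auto)
  qed (simp add: mult_outside assms RC)
  then show ?thesis using mult_outside[OF assms] by (auto simp: carrier_A)
qed

lemma mult_assoc:
  assumes x: "x \<in> carrier A" and y: "y \<in> carrier A" and z: "z \<in> carrier A"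
  shows "(x \<otimes>\<^bsub>A\<^esub> y) \<otimes>\<^bsub>A\<^esub> z = x \<otimes>\<^bsub>A\<^esub> (y \<otimes>\<^bsub>A\<^esub> z)"
proof
  fix \<rho>
  show "((x \<otimes>\<^bsub>A\<^esub> y) \<otimes>\<^bsub>A\<^esub> z) \<rho> = (x \<otimes>\<^bsub>A\<^esub> (y \<otimes>\<^bsub>A\<^esub> z)) \<rho>"
  proof (cases "\<rho> \<subseteq> {1..m}")
    case False
    then show ?thesis using mult_outside[OF mult_closed[OF x y] z] mult_outside[OF x mult_closed[OF y z]] by simp
  next
    case True
    then have fin: "finite \<rho>" using finite_subset by blast
    have "((x \<otimes>\<^bsub>A\<^esub> y) \<otimes>\<^bsub>A\<^esub> z) \<rho> = (\<Sum>\<sigma>\<in>Pow \<rho>. \<Sum>\<tau>\<in>Pow \<sigma>.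
        (str \<sigma> (\<rho> - \<sigma>) * str \<tau> (\<sigma> - \<tau>)) * (x \<tau> * y (\<sigma> - \<tau>) * z (\<rho> - \<sigma>)))"
      unfolding mult_A by (simp add: sum_distrib_left sum_distrib_right mult_ac)
    also have "\<dots> = (\<Sum>(\<sigma>, \<tau>)\<in>(SIGMA \<sigma>:Pow \<rho>. Pow \<sigma>).
        (str \<sigma> (\<rho> - \<sigma>) * str \<tau> (\<sigma> - \<tau>)) * (x \<tau> * y (\<sigma> - \<tau>) * z (\<rho> - \<sigma>)))"
      using fin finite_subset by (subst sum.Sigma) auto
    also have "\<dots> = (\<Sum>(\<tau>, \<upsilon>)\<in>(SIGMA \<tau>:Pow \<rho>. Pow (\<rho> - \<tau>)).
        (str \<tau> (\<rho> - \<tau>) * str \<upsilon> (\<rho> - \<tau> - \<upsilon>)) * (x \<tau> * y \<upsilon> * z (\<rho> - \<tau> - \<upsilon>)))"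
    proof (rule sum.reindex_bij_witness[where
          i = "\<lambda>(\<tau>, \<upsilon>). (\<tau> \<union> \<upsilon>, \<tau>)" and j = "\<lambda>(\<sigma>, \<tau>). (\<tau>, \<sigma> - \<tau>)"], goal_cases)
      case (5 a)
      obtain \<sigma> \<tau> where a: "a = (\<sigma>, \<tau>)" by force
      with 5 have sub: "\<tau> \<subseteq> \<sigma>" "\<sigma> \<subseteq> \<rho>" by auto
      have eqs: "\<tau> \<union> (\<sigma> - \<tau>) = \<sigma>" "(\<sigma> - \<tau>) \<union> (\<rho> - \<sigma>) = \<rho> - \<tau>" "\<rho> - \<tau> - (\<sigma> - \<tau>) = \<rho> - \<sigma>"
        using sub by auto
      have "str (\<tau> \<union> (\<sigma> - \<tau>)) (\<rho> - \<sigma>) * str \<tau> (\<sigma> - \<tau>)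
          = str \<tau> ((\<sigma> - \<tau>) \<union> (\<rho> - \<sigma>)) * str (\<sigma> - \<tau>) (\<rho> - \<sigma>)"
        by (rule str_assoc) (use sub True in auto)
      then have "str \<sigma> (\<rho> - \<sigma>) * str \<tau> (\<sigma> - \<tau>) = str \<tau> (\<rho> - \<tau>) * str (\<sigma> - \<tau>) (\<rho> - \<sigma>)"
        by (simp only: eqs)
      then show ?case by (simp add: a eqs)
    qed auto
    also have "\<dots> = (\<Sum>\<tau>\<in>Pow \<rho>. \<Sum>\<upsilon>\<in>Pow (\<rho> - \<tau>).
        (str \<tau> (\<rho> - \<tau>) * str \<upsilon> (\<rho> - \<tau> - \<upsilon>)) * (x \<tau> * y \<upsilon> * z (\<rho> - \<tau> - \<upsilon>)))"
      using fin finite_subset by (subst sum.Sigma) auto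
    also have "\<dots> = (x \<otimes>\<^bsub>A\<^esub> (y \<otimes>\<^bsub>A\<^esub> z)) \<rho>"
      unfolding mult_A by (simp add: sum_distrib_left sum_distrib_right mult_ac)
    finally show ?thesis .
  qed
qed

lemma gen_carrier: "\<sigma> \<subseteq> {1..m} \<Longrightarrow> gen \<sigma> \<in> carrier A"
  by (auto simp: carrier_A gen_def RC)

lemma gen_mult:
  assumes "\<sigma> \<subseteq> {1..m}" "\<tau> \<subseteq> {1..m}"
  shows "gen \<sigma> \<otimes>\<^bsub>A\<^esub> gen \<tau> =
     (if \<sigma> \<inter> \<tau> = {} then (\<lambda>\<rho>. str \<sigma> \<tau> * gen (\<sigma> \<union> \<tau>) \<rho>) else (\<lambda>_. 0))"
proof
  fix \<rho>
  show "(gen \<sigma> \<otimes>\<^bsub>A\<^esub> gen \<tau>) \<rho> =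
     (if \<sigma> \<inter> \<tau> = {} then (\<lambda>\<rho>. str \<sigma> \<tau> * gen (\<sigma> \<union> \<tau>) \<rho>) else (\<lambda>_. 0)) \<rho>"
  proof (cases "\<rho> \<subseteq> {1..m}")
    case False
    then have "\<rho> \<noteq> \<sigma> \<union> \<tau>" using assms by auto
    then show ?thesis using mult_outside[OF gen_carrier[OF assms(1)] gen_carrier[OF assms(2)] False] by (simp add: gen_def)
  next
    case True
    then have fin: "finite \<rho>" using finite_subset by blast
    have "(gen \<sigma> \<otimes>\<^bsub>A\<^esub> gen \<tau>) \<rho> =
       (\<Sum>\<sigma>'\<in>Pow \<rho>. if \<sigma>' = \<sigma> then str \<sigma> (\<rho> - \<sigma>) * gen \<tau> (\<rho> - \<sigma>) else 0)"
      unfolding mult_A by (intro sum.cong) (auto simp: gen_def)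
    also have "\<dots> = (if \<sigma> \<subseteq> \<rho> then str \<sigma> (\<rho> - \<sigma>) * gen \<tau> (\<rho> - \<sigma>) else 0)"
      using fin by simp
    also have "\<dots> = (if \<sigma> \<inter> \<tau> = {} then (\<lambda>\<rho>. str \<sigma> \<tau> * gen (\<sigma> \<union> \<tau>) \<rho>) else (\<lambda>_. 0)) \<rho>"
    proof -
      have "\<sigma> \<subseteq> \<rho> \<and> \<rho> - \<sigma> = \<tau> \<longleftrightarrow> \<sigma> \<inter> \<tau> = {} \<and> \<rho> = \<sigma> \<union> \<tau>" by auto
      then show ?thesis by (auto simp: gen_def)
    qed
    finally show ?thesis .
  qed
qed

lemma add_mult: "(x \<oplus>\<^bsub>A\<^esub> y) \<otimes>\<^bsub>A\<^esub> z = (x \<otimes>\<^bsub>A\<^esub> z) \<oplus>\<^bsub>A\<^esub> (y \<otimes>\<^bsub>A\<^esub> z)"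
  and mult_add: "z \<otimes>\<^bsub>A\<^esub> (x \<oplus>\<^bsub>A\<^esub> y) = (z \<otimes>\<^bsub>A\<^esub> x) \<oplus>\<^bsub>A\<^esub> (z \<otimes>\<^bsub>A\<^esub> y)"
  by (auto simp: fun_eq_iff mult_A add_A algebra_simps sum.distrib)

lemma smult_mult: "(r \<odot>\<^bsub>A\<^esub> x) \<otimes>\<^bsub>A\<^esub> z = r \<odot>\<^bsub>A\<^esub> (x \<otimes>\<^bsub>A\<^esub> z)"
  and mult_smult: "z \<otimes>\<^bsub>A\<^esub> (r \<odot>\<^bsub>A\<^esub> x) = r \<odot>\<^bsub>A\<^esub> (z \<otimes>\<^bsub>A\<^esub> x)"
  by (auto simp: fun_eq_iff mult_A smult_A sum_distrib_left mult_ac)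

lemma one_mult:
  assumes "x \<in> carrier A" shows "gen {} \<otimes>\<^bsub>A\<^esub> x = x" "x \<otimes>\<^bsub>A\<^esub> gen {} = x"
proof -
  have g: "gen {} \<in> carrier A" by (simp add: gen_carrier)
  have "(gen {} \<otimes>\<^bsub>A\<^esub> x) \<rho> = x \<rho> \<and> (x \<otimes>\<^bsub>A\<^esub> gen {}) \<rho> = x \<rho>" for \<rho>
  proof (cases "\<rho> \<subseteq> {1..m}")
    case False
    then show ?thesis
      using mult_outside[OF assms g False] mult_outside[OF g assms False] in_carrier(2)[OF assms False] by simp
  next
    case True
    then have fin: "finite \<rho>" using finite_subset by blast
    have s: "str {} \<rho> = 1" "str \<rho> {} = 1"
      using c_pos[OF True] by (auto simp: str_def)
    have "(gen {} \<otimes>\<^bsub>A\<^esub> x) \<rho> = (\<Sum>\<sigma>\<in>Pow \<rho>. if \<sigma> = {} then x \<rho> else 0)"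
      unfolding mult_A by (intro sum.cong) (auto simp: gen_def s)
    moreover have "(x \<otimes>\<^bsub>A\<^esub> gen {}) \<rho> = (\<Sum>\<sigma>\<in>Pow \<rho>. if \<sigma> = \<rho> then x \<rho> else 0)"
      unfolding mult_A by (intro sum.cong) (auto simp: gen_def s)
    ultimately show ?thesis using fin by simp
  qed
  then show "gen {} \<otimes>\<^bsub>A\<^esub> x = x" "x \<otimes>\<^bsub>A\<^esub> gen {} = x" by auto
qed

lemma abelian_group_A: "abelian_group A"
proof (rule abelian_groupI)
  fix x assume "x \<in> carrier A"
  then have "(\<lambda>\<sigma>. - x \<sigma>) \<in> carrier A" by (auto simp: carrier_A RC)
  then show "\<exists>y\<in>carrier A. y \<oplus>\<^bsub>A\<^esub> x = \<zero>\<^bsub>A\<^esub>"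
    by (rule bexI[rotated]) (auto simp: add_A zero_A)
next
  fix x y assume "x \<in> carrier A" "y \<in> carrier A"
  then show "x \<oplus>\<^bsub>A\<^esub> y \<in> carrier A"
    unfolding carrier_A add_A mem_Collect_eq using RC(3) by (metis add_0)
qed (auto simp: carrier_A add_A zero_A RC algebra_simps)

lemma ring_A: "ring A"
proof (rule ringI[OF abelian_group_A])
  show "monoid A"
    by (rule monoidI)
      (auto simp: one_A mult_assoc mult_closed one_mult gen_carrier)
qed (auto simp: add_mult mult_add)

lemma module_A: "module (ring_of R) A"
  by (rule moduleI[OF cring_ring_of[OF R] abelian_group_A])
    (auto simp: carrier_A smult_A add_A rat_ring_def RC algebra_simps)

lemma piece_carrier: "coeff_piece R m d n \<subseteq> carrier A"
  by (auto simp: coeff_piece_def carrier_A)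

lemma mult_piece:
  assumes x: "x \<in> coeff_piece R m d p" and y: "y \<in> coeff_piece R m d q"
  shows "x \<otimes>\<^bsub>A\<^esub> y \<in> coeff_piece R m d (p + q)"
proof -
  have xy: "x \<otimes>\<^bsub>A\<^esub> y \<in> carrier A" using x y piece_carrier by (auto intro!: mult_closed)
  have "sum d \<rho> = p + q" if nz: "(x \<otimes>\<^bsub>A\<^esub> y) \<rho> \<noteq> 0" for \<rho>
  proof -
    from nz have "\<rho> \<subseteq> {1..m}" using xy by (auto simp: carrier_A)
    then have fin: "finite \<rho>" using finite_subset by blast
    from nz obtain \<sigma> where s: "\<sigma> \<subseteq> \<rho>" "x \<sigma> \<noteq> 0" "y (\<rho> - \<sigma>) \<noteq> 0"
      unfolding mult_A by (metis (no_types, lifting) Pow_iff mult_eq_0_iff sum.neutral)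
    then have "sum d \<sigma> = p" "sum d (\<rho> - \<sigma>) = q" using x y by (auto simp: coeff_piece_def)
    then show ?thesis using sum.subset_diff[OF s(1) fin, of d] by simp
  qed
  then show ?thesis using xy by (auto simp: carrier_A coeff_piece_def)
qed

lemma mult_comm:
  assumes x: "x \<in> coeff_piece R m d p" and y: "y \<in> coeff_piece R m d q"
  shows "x \<otimes>\<^bsub>A\<^esub> y = (-1) ^ (p * q) \<odot>\<^bsub>A\<^esub> (y \<otimes>\<^bsub>A\<^esub> x)"
proof
  fix \<rho>
  have xy: "x \<in> carrier A" "y \<in> carrier A" using x y piece_carrier by auto
  show "(x \<otimes>\<^bsub>A\<^esub> y) \<rho> = ((-1) ^ (p * q) \<odot>\<^bsub>A\<^esub> (y \<otimes>\<^bsub>A\<^esub> x)) \<rho>"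
  proof (cases "\<rho> \<subseteq> {1..m}")
    case False
    then show ?thesis
      using mult_outside[OF xy False] mult_outside[OF xy(2,1) False] by (simp add: smult_A)
  next
    case True
    then have fin: "finite \<rho>" using finite_subset by blast
    have "(x \<otimes>\<^bsub>A\<^esub> y) \<rho> = (\<Sum>\<tau>\<in>Pow \<rho>. str (\<rho> - \<tau>) \<tau> * (x (\<rho> - \<tau>) * y \<tau>))"
      unfolding mult_A
      by (rule sum.reindex_bij_witness[where i = "\<lambda>\<tau>. \<rho> - \<tau>" and j = "\<lambda>\<tau>. \<rho> - \<tau>"])
        (auto simp: double_diff)
    also have "\<dots> = (\<Sum>\<tau>\<in>Pow \<rho>. (-1) ^ (p * q) * (str \<tau> (\<rho> - \<tau>) * (y \<tau> * x (\<rho> - \<tau>))))"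
    proof (rule sum.cong[OF refl])
      fix \<tau> assume t: "\<tau> \<in> Pow \<rho>"
      show "str (\<rho> - \<tau>) \<tau> * (x (\<rho> - \<tau>) * y \<tau>)
         = (-1) ^ (p * q) * (str \<tau> (\<rho> - \<tau>) * (y \<tau> * x (\<rho> - \<tau>)))"
      proof (cases "x (\<rho> - \<tau>) = 0 \<or> y \<tau> = 0")
        case False
        then have "sum d (\<rho> - \<tau>) = p" "sum d \<tau> = q" using x y by (auto simp: coeff_piece_def)
        moreover have "(\<rho> - \<tau>) \<inter> \<tau> = {}" by auto
        moreover have "finite \<tau>" using t fin finite_subset by auto
        ultimately show ?thesis
          using sign_swap[of "\<rho> - \<tau>" \<tau>] fin
          by (simp add: str_def Un_commute mult_ac)
      qed auto
    qed
    also have "\<dots> = ((-1) ^ (p * q) \<odot>\<^bsub>A\<^esub> (y \<otimes>\<^bsub>A\<^esub> x)) \<rho>"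
      by (simp add: smult_A mult_A sum_distrib_left)
    finally show ?thesis .
  qed
qed

lemma gen_prod:
  assumes "\<sigma> \<subseteq> {1..m}"
  shows "foldr (\<lambda>i x. gen {i} \<otimes>\<^bsub>A\<^esub> x) (sorted_list_of_set \<sigma>) (gen {}) = of_nat (c \<sigma>) \<odot>\<^bsub>A\<^esub> gen \<sigma>"
proof -
  have "finite \<sigma>" using assms finite_subset by blast
  then show ?thesis using assms
  proof (induction \<sigma> rule: finite_psubset_induct)
    case (psubset \<sigma>)
    show ?case
    proof (cases "\<sigma> = {}")
      case True
      then show ?thesis by (simp add: smult_A gen_def fun_eq_iff)
    next
      case False
      define j where "j = Min \<sigma>"
      define \<tau> where "\<tau> = \<sigma> - {j}"
      have j: "j \<in> \<sigma>" using False psubset(1) by (simp add: j_def)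
      have lt: "j < k" if "k \<in> \<tau>" for k
        using that psubset(1) by (auto simp: j_def \<tau>_def order.strict_iff_order)
      have un: "{j} \<union> \<tau> = \<sigma>" "{j} \<inter> \<tau> = {}" and ss: "\<tau> \<subset> \<sigma>" using j by (auto simp: \<tau>_def)
      have "foldr (\<lambda>i x. gen {i} \<otimes>\<^bsub>A\<^esub> x) (sorted_list_of_set \<sigma>) (gen {})
          = gen {j} \<otimes>\<^bsub>A\<^esub> (of_nat (c \<tau>) \<odot>\<^bsub>A\<^esub> gen \<tau>)"
        using psubset(2)[OF ss] psubset.prems ss
        by (simp add: sorted_list_of_set_nonempty[OF psubset(1) False] j_def \<tau>_def)
      also have "\<dots> = of_nat (c \<tau>) \<odot>\<^bsub>A\<^esub> (\<lambda>\<rho>. str {j} \<tau> * gen \<sigma> \<rho>)"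
        using gen_mult[of "{j}" \<tau>] un j ss psubset.prems by (auto simp: mult_smult)
      also have "\<dots> = of_nat (c \<sigma>) \<odot>\<^bsub>A\<^esub> gen \<sigma>"
        using c_pos[of \<tau>] c_single[of j] un ss psubset.prems j lt sign_increasing[of "{j}" \<tau>]
        by (auto simp: smult_A str_def fun_eq_iff)
      finally show ?thesis .
    qed
  qed
qed

theorem coeff_algebra_presents: "presents R m d c A"
proof -
  have "gen {} \<in> coeff_piece R m d 0" by (auto simp: coeff_piece_def gen_def RC)
  moreover have "gen {i} \<otimes>\<^bsub>A\<^esub> gen {i} = (\<lambda>_. 0)" if "i \<in> {1..m}" for i
    using that gen_mult[of "{i}" "{i}"] by auto
  ultimately show ?thesis
    unfolding presents_def one_A zero_A
    using module_A ring_A smult_mult mult_smult mult_piece mult_comm gen_prod by blast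
qed

lemma carrier_induct [consumes 1, case_names zero add]:
  assumes x: "x \<in> carrier A" and zero: "P (\<lambda>_. 0)"
    and add: "\<And>x r \<sigma>. x \<in> carrier A \<Longrightarrow> r \<in> R \<Longrightarrow> \<sigma> \<subseteq> {1..m} \<Longrightarrow> P x \<Longrightarrow>
      P (x \<oplus>\<^bsub>A\<^esub> (r \<odot>\<^bsub>A\<^esub> gen \<sigma>))"
  shows "P x"
proof -
  have "P (\<lambda>\<sigma>. if \<sigma> \<in> S then x \<sigma> else 0)" if "S \<subseteq> Pow {1..m}" for S
  proof -
    from that have "finite S" using finite_subset by blast
    then show ?thesis using that
    proof (induction S)
      case (insert \<sigma> S)
      have "(\<lambda>\<rho>. if \<rho> \<in> insert \<sigma> S then x \<rho> else 0)
          = (\<lambda>\<sigma>. if \<sigma> \<in> S then x \<sigma> else 0) \<oplus>\<^bsub>A\<^esub> (x \<sigma> \<odot>\<^bsub>A\<^esub> gen \<sigma>)"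
        using insert by (auto simp: fun_eq_iff add_A smult_A gen_def)
      moreover have "P \<dots>"
        using insert x by (intro add) (auto simp: carrier_A RC)
      ultimately show ?case by simp
    qed (simp add: zero)
  qed
  from this[OF order_refl] have "P (\<lambda>\<sigma>. if \<sigma> \<in> Pow {1..m} then x \<sigma> else 0)" .
  moreover have "(\<lambda>\<sigma>. if \<sigma> \<in> Pow {1..m} then x \<sigma> else 0) = x"
    using x by (auto simp: carrier_A fun_eq_iff)
  ultimately show ?thesis by simp
qed

text \<open>\<open>gprod M \<sigma>\<close> is the increasing product of the generators over \<open>\<sigma>\<close>.\<close>

definition gprod :: "(rat, nat set \<Rightarrow> rat) module \<Rightarrow> nat set \<Rightarrow> nat set \<Rightarrow> rat" where
  "gprod M \<sigma> = foldr (\<lambda>i x. gen {i} \<otimes>\<^bsub>M\<^esub> x) (sorted_list_of_set \<sigma>) \<one>\<^bsub>M\<^esub>"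

context
  fixes \<mu> :: "(nat set \<Rightarrow> rat) \<Rightarrow> (nat set \<Rightarrow> rat) \<Rightarrow> nat set \<Rightarrow> rat"
    and M :: "(rat, nat set \<Rightarrow> rat) module"
  assumes M_def: "M = A\<lparr>monoid.mult := \<mu>\<rparr>" and M: "presents R m d c M"
begin

interpretation M: module "ring_of R" M using M by (simp add: presents_def)
interpretation M: ring M using M by (simp add: presents_def)

lemma M_A: "carrier M = carrier A" "\<one>\<^bsub>M\<^esub> = gen {}" "\<zero>\<^bsub>M\<^esub> = (\<lambda>_. 0)"
  "x \<oplus>\<^bsub>M\<^esub> y = x \<oplus>\<^bsub>A\<^esub> y" "r \<odot>\<^bsub>M\<^esub> x = r \<odot>\<^bsub>A\<^esub> x"
  by (auto simp: M_def one_A zero_A coeff_algebra_def)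

lemma M_smult:
  assumes "r \<in> R" "x \<in> carrier M" "y \<in> carrier M"
  shows "(r \<odot>\<^bsub>M\<^esub> x) \<otimes>\<^bsub>M\<^esub> y = r \<odot>\<^bsub>M\<^esub> (x \<otimes>\<^bsub>M\<^esub> y)" "x \<otimes>\<^bsub>M\<^esub> (r \<odot>\<^bsub>M\<^esub> y) = r \<odot>\<^bsub>M\<^esub> (x \<otimes>\<^bsub>M\<^esub> y)"
proof -
  have "\<forall>r\<in>R. \<forall>x\<in>carrier M. \<forall>y\<in>carrier M. (r \<odot>\<^bsub>M\<^esub> x) \<otimes>\<^bsub>M\<^esub> y = r \<odot>\<^bsub>M\<^esub> (x \<otimes>\<^bsub>M\<^esub> y) \<and>
      x \<otimes>\<^bsub>M\<^esub> (r \<odot>\<^bsub>M\<^esub> y) = r \<odot>\<^bsub>M\<^esub> (x \<otimes>\<^bsub>M\<^esub> y)"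
    using M unfolding presents_def by (elim conjE) assumption
  then show "(r \<odot>\<^bsub>M\<^esub> x) \<otimes>\<^bsub>M\<^esub> y = r \<odot>\<^bsub>M\<^esub> (x \<otimes>\<^bsub>M\<^esub> y)"
    "x \<otimes>\<^bsub>M\<^esub> (r \<odot>\<^bsub>M\<^esub> y) = r \<odot>\<^bsub>M\<^esub> (x \<otimes>\<^bsub>M\<^esub> y)"
    using assms by simp_all
qed

lemma M_square: "i \<in> {1..m} \<Longrightarrow> gen {i} \<otimes>\<^bsub>M\<^esub> gen {i} = \<zero>\<^bsub>M\<^esub>"
  using M unfolding presents_def by (elim conjE) (rule bspec)

lemma M_comm:
  assumes "x \<in> coeff_piece R m d p" "y \<in> coeff_piece R m d q"
  shows "x \<otimes>\<^bsub>M\<^esub> y = (-1) ^ (p * q) \<odot>\<^bsub>M\<^esub> (y \<otimes>\<^bsub>M\<^esub> x)"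
proof -
  have H: "\<forall>p q. \<forall>x\<in>coeff_piece R m d p. \<forall>y\<in>coeff_piece R m d q.
        x \<otimes>\<^bsub>M\<^esub> y \<in> coeff_piece R m d (p + q) \<and>
        x \<otimes>\<^bsub>M\<^esub> y = (-1) ^ (p * q) \<odot>\<^bsub>M\<^esub> (y \<otimes>\<^bsub>M\<^esub> x)"
    using M unfolding presents_def by (elim conjE) assumption
  show ?thesis by (rule conjunct2[OF H[rule_format, OF assms]])
qed

lemma M_gprod: "\<sigma> \<subseteq> {1..m} \<Longrightarrow> gprod M \<sigma> = of_nat (c \<sigma>) \<odot>\<^bsub>M\<^esub> gen \<sigma>"
  using M unfolding presents_def gprod_def by (elim conjE) (rule mp, rule spec)

lemma M_gen: "\<sigma> \<subseteq> {1..m} \<Longrightarrow> gen \<sigma> \<in> carrier M"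
  by (simp add: M_A gen_carrier)

lemma M_swap:
  assumes "i \<in> {1..m}" "j \<in> {1..m}"
  shows "gen {i} \<otimes>\<^bsub>M\<^esub> gen {j} = (-1) ^ (d i * d j) \<odot>\<^bsub>M\<^esub> (gen {j} \<otimes>\<^bsub>M\<^esub> gen {i})"
proof -
  have "gen {k} \<in> coeff_piece R m d (d k)" if "k \<in> {1..m}" for k
    using that by (auto simp: coeff_piece_def gen_def RC)
  then show ?thesis using assms by (intro M_comm)
qed

lemma gprod_eq: "\<sigma> \<subseteq> {1..m} \<Longrightarrow> gprod M \<sigma> = (\<lambda>\<rho>. of_nat (c \<sigma>) * gen \<sigma> \<rho>)"
  by (simp add: M_gprod M_A smult_A)

lemma gprod_closed: "\<sigma> \<subseteq> {1..m} \<Longrightarrow> gprod M \<sigma> \<in> carrier M"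
  using gen_carrier[of \<sigma>] by (auto simp: gprod_eq M_A carrier_A RC R_of_nat)

lemma gprod_insert:
  assumes "insert j \<tau> \<subseteq> {1..m}" "\<And>k. k \<in> \<tau> \<Longrightarrow> j < k"
  shows "gprod M (insert j \<tau>) = gen {j} \<otimes>\<^bsub>M\<^esub> gprod M \<tau>"
proof -
  have fin: "finite (insert j \<tau>)" using finite_subset[OF assms(1)] by simp
  have min: "Min (insert j \<tau>) = j"
    using assms(2) fin by (intro Min_eqI) (auto simp: less_imp_le)
  have "insert j \<tau> - {j} = \<tau>" using assms(2) by auto
  then show ?thesis
    using sorted_list_of_set_nonempty[OF fin] by (simp add: gprod_def min)
qed

lemma smult_one_M: "x \<in> carrier M \<Longrightarrow> 1 \<odot>\<^bsub>M\<^esub> x = x"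
  by (simp add: M_A smult_A)

lemma R_sign: "koszul_sign d \<sigma> \<tau> \<in> R" "(-1) ^ n \<in> R"
  using sign_cases[of \<sigma> \<tau>] RC by (auto simp: minus_one_power_iff)

lemma gen_gprod:
  assumes "finite \<tau>" "\<tau> \<subseteq> {1..m}" "i \<in> {1..m}"
  shows "gen {i} \<otimes>\<^bsub>M\<^esub> gprod M \<tau> =
     (if i \<in> \<tau> then \<zero>\<^bsub>M\<^esub> else koszul_sign d {i} \<tau> \<odot>\<^bsub>M\<^esub> gprod M (insert i \<tau>))"
  using assms
proof (induction \<tau> rule: finite_psubset_induct)
  case (psubset \<tau>)
  have i: "gen {i} \<in> carrier M" using psubset.prems by (intro M_gen) auto
  show ?case
  proof (cases "\<tau> = {} \<or> i < Min \<tau>")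
    case True
    then have lt: "i < k" if "k \<in> \<tau>" for k
      using that psubset(1) by (metis Min_gr_iff empty_iff)
    then have "koszul_sign d {i} \<tau> = 1" by (intro sign_increasing) auto
    moreover have "i \<notin> \<tau>" using lt by blast
    ultimately show ?thesis
      using gprod_insert[of i \<tau>] lt psubset.prems gprod_closed[of "insert i \<tau>"]
      by (simp add: smult_one_M)
  next
    case False
    define j where "j = Min \<tau>"
    define \<upsilon> where "\<upsilon> = \<tau> - {j}"
    have j: "j \<in> \<tau>" using False psubset(1) by (simp add: j_def)
    have lt: "j < k" if "k \<in> \<upsilon>" for k
      using that psubset(1) by (auto simp: j_def \<upsilon>_def order.strict_iff_order)
    have un: "insert j \<upsilon> = \<tau>" and ss: "\<upsilon> \<subset> \<tau>" using j by (auto simp: \<upsilon>_def)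
    have gj: "gen {j} \<in> carrier M" using j psubset.prems by (intro M_gen) auto
    have gu: "gprod M \<upsilon> \<in> carrier M" using ss psubset.prems by (intro gprod_closed) auto
    have split: "gprod M \<tau> = gen {j} \<otimes>\<^bsub>M\<^esub> gprod M \<upsilon>"
      using gprod_insert[of j \<upsilon>] lt psubset.prems un by simp
    show ?thesis
    proof (cases "i = j")
      case True
      have "gen {i} \<otimes>\<^bsub>M\<^esub> gen {i} = \<zero>\<^bsub>M\<^esub>" using psubset.prems by (intro M_square) auto
      then show ?thesis using True j gu gj M.m_assoc[of "gen {j}" "gen {j}"] by (simp add: split)
    next
      case neq: False
      then have ij: "j < i" using False by (auto simp: j_def)
      have jm: "j \<in> {1..m}" using j psubset.prems by auto
      have IH: "gen {i} \<otimes>\<^bsub>M\<^esub> gprod M \<upsilon> =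
        (if i \<in> \<upsilon> then \<zero>\<^bsub>M\<^esub> else koszul_sign d {i} \<upsilon> \<odot>\<^bsub>M\<^esub> gprod M (insert i \<upsilon>))"
        using psubset(2)[OF ss] psubset.prems ss by auto
      have "gen {i} \<otimes>\<^bsub>M\<^esub> gprod M \<tau> = (gen {i} \<otimes>\<^bsub>M\<^esub> gen {j}) \<otimes>\<^bsub>M\<^esub> gprod M \<upsilon>"
        using i gj gu by (simp add: split M.m_assoc)
      also have "\<dots> = (-1) ^ (d i * d j) \<odot>\<^bsub>M\<^esub> (gen {j} \<otimes>\<^bsub>M\<^esub> (gen {i} \<otimes>\<^bsub>M\<^esub> gprod M \<upsilon>))"
        using i gj gu R_sign
        by (simp add: M_swap[OF psubset.prems(2) jm] M_smult M.m_assoc)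
      finally have *: "gen {i} \<otimes>\<^bsub>M\<^esub> gprod M \<tau> =
        (-1) ^ (d i * d j) \<odot>\<^bsub>M\<^esub> (gen {j} \<otimes>\<^bsub>M\<^esub> (gen {i} \<otimes>\<^bsub>M\<^esub> gprod M \<upsilon>))" .
      show ?thesis
      proof (cases "i \<in> \<upsilon>")
        case True
        then have "gen {i} \<otimes>\<^bsub>M\<^esub> gprod M \<tau> = \<zero>\<^bsub>M\<^esub>"
          using * IH gj R_sign by simp
        then show ?thesis using True un by auto
      next
        case notin: False
        have giu: "gprod M (insert i \<upsilon>) \<in> carrier M"
          using ss psubset.prems by (intro gprod_closed) auto
        have "gen {j} \<otimes>\<^bsub>M\<^esub> gprod M (insert i \<upsilon>) = gprod M (insert j (insert i \<upsilon>))"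
          using lt ij ss psubset.prems j by (subst gprod_insert) auto
        then have step: "gen {j} \<otimes>\<^bsub>M\<^esub> gprod M (insert i \<upsilon>) = gprod M (insert i \<tau>)"
          using un by (simp add: insert_commute)
        have "koszul_sign d {i} \<tau> = koszul_sign d {i} {j} * koszul_sign d {i} \<upsilon>"
          using sign_Un_right[of "{j}" \<upsilon> "{i}"] un psubset(1) finite_subset[of \<upsilon> \<tau>] ss lt by auto
        then have "koszul_sign d {i} \<tau> = (-1) ^ (d i * d j) * koszul_sign d {i} \<upsilon>"
          using ij by (simp add: sign_single)
        then show ?thesis
          using * IH notin neq un gj giu step R_sign
          by (auto simp: M_smult) (simp add: M_A smult_A mult.assoc)
      qed
    qed
  qed
qed

lemma gprod_gprod:
  assumes "finite \<sigma>" "\<sigma> \<subseteq> {1..m}" "\<tau> \<subseteq> {1..m}"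
  shows "gprod M \<sigma> \<otimes>\<^bsub>M\<^esub> gprod M \<tau> =
     (if \<sigma> \<inter> \<tau> = {} then koszul_sign d \<sigma> \<tau> \<odot>\<^bsub>M\<^esub> gprod M (\<sigma> \<union> \<tau>) else \<zero>\<^bsub>M\<^esub>)"
  using assms
proof (induction \<sigma> rule: finite_psubset_induct)
  case (psubset \<sigma>)
  have gt: "gprod M \<tau> \<in> carrier M" using psubset.prems by (intro gprod_closed)
  have fint: "finite \<tau>" using finite_subset[OF psubset.prems(2)] by simp
  show ?case
  proof (cases "\<sigma> = {}")
    case True
    have "gprod M {} = \<one>\<^bsub>M\<^esub>" by (simp add: gprod_def)
    then show ?thesis using True gt by (simp add: smult_one_M)
  next
    case False
    define j where "j = Min \<sigma>"
    define \<upsilon> where "\<upsilon> = \<sigma> - {j}"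
    have j: "j \<in> \<sigma>" using False psubset(1) by (simp add: j_def)
    have lt: "j < k" if "k \<in> \<upsilon>" for k
      using that psubset(1) by (auto simp: j_def \<upsilon>_def order.strict_iff_order)
    have un: "insert j \<upsilon> = \<sigma>" and ss: "\<upsilon> \<subset> \<sigma>" and ju: "j \<notin> \<upsilon>" using j by (auto simp: \<upsilon>_def)
    have finu: "finite \<upsilon>" using psubset(1) ss finite_subset by blast
    have jm: "j \<in> {1..m}" using j psubset.prems by auto
    have gj: "gen {j} \<in> carrier M" using jm by (intro M_gen) auto
    have gu: "gprod M \<upsilon> \<in> carrier M" using ss psubset.prems by (intro gprod_closed) auto
    have "gprod M \<sigma> \<otimes>\<^bsub>M\<^esub> gprod M \<tau> = gen {j} \<otimes>\<^bsub>M\<^esub> (gprod M \<upsilon> \<otimes>\<^bsub>M\<^esub> gprod M \<tau>)"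
      using gprod_insert[of j \<upsilon>] lt psubset.prems un gj gu gt by (simp add: M.m_assoc)
    also have "\<dots> = gen {j} \<otimes>\<^bsub>M\<^esub>
      (if \<upsilon> \<inter> \<tau> = {} then koszul_sign d \<upsilon> \<tau> \<odot>\<^bsub>M\<^esub> gprod M (\<upsilon> \<union> \<tau>) else \<zero>\<^bsub>M\<^esub>)"
      using psubset(2)[OF ss] psubset.prems ss by auto
    finally have *: "gprod M \<sigma> \<otimes>\<^bsub>M\<^esub> gprod M \<tau> = \<dots>" .
    show ?thesis
    proof (cases "\<upsilon> \<inter> \<tau> = {}")
      case ne: False
      then have "\<sigma> \<inter> \<tau> \<noteq> {}" using ss by auto
      with ne * gj show ?thesis by simp
    next
      case True
      have gut: "gprod M (\<upsilon> \<union> \<tau>) \<in> carrier M" using ss psubset.prems by (intro gprod_closed) auto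
      have **: "gprod M \<sigma> \<otimes>\<^bsub>M\<^esub> gprod M \<tau> =
        koszul_sign d \<upsilon> \<tau> \<odot>\<^bsub>M\<^esub> (gen {j} \<otimes>\<^bsub>M\<^esub> gprod M (\<upsilon> \<union> \<tau>))"
        using * True gj gut R_sign by (simp add: M_smult)
      have step: "gen {j} \<otimes>\<^bsub>M\<^esub> gprod M (\<upsilon> \<union> \<tau>) =
        (if j \<in> \<upsilon> \<union> \<tau> then \<zero>\<^bsub>M\<^esub>
         else koszul_sign d {j} (\<upsilon> \<union> \<tau>) \<odot>\<^bsub>M\<^esub> gprod M (insert j (\<upsilon> \<union> \<tau>)))"
        by (rule gen_gprod) (use finu fint ss psubset.prems jm in auto)
      show ?thesis
      proof (cases "j \<in> \<tau>")
        case jt: True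
        then have "\<sigma> \<inter> \<tau> \<noteq> {}" using j by auto
        with jt ** step show ?thesis by (simp add: M_A smult_A)
      next
        case jt: False
        have "koszul_sign d {j} (\<upsilon> \<union> \<tau>) = koszul_sign d {j} \<tau>"
          using sign_Un_right[OF finu fint True, of "{j}"] sign_increasing[of "{j}" \<upsilon>] lt by auto
        moreover have "koszul_sign d \<sigma> \<tau> = koszul_sign d {j} \<tau> * koszul_sign d \<upsilon> \<tau>"
          using sign_Un_left[of "{j}" \<upsilon> \<tau>] finu ju un by auto
        moreover have "\<sigma> \<inter> \<tau> = {}" "insert j (\<upsilon> \<union> \<tau>) = \<sigma> \<union> \<tau>" using jt True un by auto
        ultimately show ?thesis
          using ** step jt ju by (simp add: M_A smult_A mult_ac)
      qed
    qed
  qed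
qed

lemma gen_gen_scaled:
  assumes "\<sigma> \<subseteq> {1..m}" "\<tau> \<subseteq> {1..m}"
  shows "gen \<sigma> \<otimes>\<^bsub>M\<^esub> gen \<tau> = (\<lambda>\<rho>. (if \<sigma> \<inter> \<tau> = {}
      then koszul_sign d \<sigma> \<tau> * (of_nat (c (\<sigma> \<union> \<tau>)) * gen (\<sigma> \<union> \<tau>) \<rho>) else 0)
      / (of_nat (c \<sigma>) * of_nat (c \<tau>)))"
proof -
  have fin: "finite \<sigma>" using assms finite_subset by blast
  have pos: "c \<sigma> > 0" "c \<tau> > 0" using assms c_pos by auto
  have g: "gprod M \<upsilon> = of_nat (c \<upsilon>) \<odot>\<^bsub>M\<^esub> gen \<upsilon>" if "\<upsilon> \<subseteq> {1..m}" for \<upsilon>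
    using gprod_eq[OF that] by (simp add: M_A smult_A)
  have "gprod M \<sigma> \<otimes>\<^bsub>M\<^esub> gprod M \<tau> =
      of_nat (c \<sigma>) \<odot>\<^bsub>M\<^esub> (of_nat (c \<tau>) \<odot>\<^bsub>M\<^esub> (gen \<sigma> \<otimes>\<^bsub>M\<^esub> gen \<tau>))"
  proof -
    have "of_nat (c \<tau>) \<odot>\<^bsub>M\<^esub> gen \<tau> \<in> carrier M"
      using g[OF assms(2)] gprod_closed[OF assms(2)] by simp
    then show ?thesis
      using assms by (simp add: g M_smult R_of_nat M_gen) (simp add: M_A smult_A mult_ac)
  qed
  also have "\<dots> = (\<lambda>\<rho>. (of_nat (c \<sigma>) * of_nat (c \<tau>)) * (gen \<sigma> \<otimes>\<^bsub>M\<^esub> gen \<tau>) \<rho>)"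
    by (simp add: M_A smult_A mult_ac)
  finally have "(of_nat (c \<sigma>) * of_nat (c \<tau>)) * (gen \<sigma> \<otimes>\<^bsub>M\<^esub> gen \<tau>) \<rho> =
      (if \<sigma> \<inter> \<tau> = {} then koszul_sign d \<sigma> \<tau> * (of_nat (c (\<sigma> \<union> \<tau>)) * gen (\<sigma> \<union> \<tau>) \<rho>) else 0)" for \<rho>
    using gprod_gprod[OF fin assms] assms
    by (simp add: M_A smult_A gprod_eq fun_eq_iff split: if_splits)
  then show ?thesis
    using pos by (simp add: fun_eq_iff field_simps)
qed

lemma gen_gen: "\<sigma> \<subseteq> {1..m} \<Longrightarrow> \<tau> \<subseteq> {1..m} \<Longrightarrow> gen \<sigma> \<otimes>\<^bsub>M\<^esub> gen \<tau> = gen \<sigma> \<otimes>\<^bsub>A\<^esub> gen \<tau>"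
  by (auto simp: gen_gen_scaled gen_mult str_def fun_eq_iff)

lemma mult_M:
  assumes x: "x \<in> carrier A" and y: "y \<in> carrier A"
  shows "x \<otimes>\<^bsub>M\<^esub> y = x \<otimes>\<^bsub>A\<^esub> y"
proof -
  interpret A: ring A by (rule ring_A)
  have sc: "r \<odot>\<^bsub>A\<^esub> gen \<sigma> \<in> carrier A" if "r \<in> R" "\<sigma> \<subseteq> {1..m}" for r \<sigma>
    using gen_carrier[OF that(2)] that(1) by (auto simp: carrier_A smult_A RC)
  have right: "gen \<sigma> \<otimes>\<^bsub>M\<^esub> y = gen \<sigma> \<otimes>\<^bsub>A\<^esub> y" if s: "\<sigma> \<subseteq> {1..m}" for \<sigma>
    using y
  proof (induction y rule: carrier_induct)
    case zero
    show ?case using M.r_null[of "gen \<sigma>"] A.r_null[of "gen \<sigma>"] gen_carrier[OF s]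
      by (simp add: M_A zero_A)
  next
    case (add y r \<tau>)
    then show ?case
      using M.r_distr[of y "r \<odot>\<^bsub>A\<^esub> gen \<tau>" "gen \<sigma>"] M_smult(2)[of r "gen \<sigma>" "gen \<tau>"] s
      by (simp add: M_A gen_carrier sc mult_add mult_smult gen_gen)
  qed
  show ?thesis
    using x
  proof (induction x rule: carrier_induct)
    case zero
    show ?case using M.l_null[of y] A.l_null[of y] y by (simp add: M_A zero_A)
  next
    case (add x r \<tau>)
    then show ?case
      using M.l_distr[of x "r \<odot>\<^bsub>A\<^esub> gen \<tau>" y] M_smult(1)[of r "gen \<tau>" y] y
      by (simp add: M_A gen_carrier sc add_mult smult_mult right)
  qed
qed

end

theorem coeff_algebra_unique:
  assumes "presents R m d c (A\<lparr>monoid.mult := \<mu>\<rparr>)" "x \<in> carrier A" "y \<in> carrier A"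
  shows "\<mu> x y = x \<otimes>\<^bsub>A\<^esub> y"
  using mult_M[OF refl assms] by simp

end

end

end

theory Submission
  imports Defs
begin

text \<open>Rationally, \<open>a\<^sub>\<sigma>\<close> is \<open>(1 / c \<sigma>) \<Prod>\<^sub>i\<^sub>\<in>\<^sub>\<sigma> a\<^sub>i\<close>, so every \<open>A(c)\<close> is an \<open>R\<close>-lattice inside one
  and the same \<open>\<rat>\<close>-algebra, generated by \<open>a\<^sub>1, \<dots>, a\<^sub>m\<close> with squares zero, and a change of \<open>c\<close>
  only rescales the basis vectors of the lattice. If the ratios \<open>c' \<sigma> / c \<sigma>\<close> are units of \<open>R\<close>,
  the two lattices coincide (\<open>coeff_algebra_iso_of_unit_ratios\<close>).

  It remains to remove from each \<open>c \<sigma>\<close> the part composed of the primes that are invertible in \<open>R\<close>.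
  That part is a unit of \<open>R\<close>, because a product of units is one (\<open>unit_ratio_prime_part\<close>), and
  what is left is coprime to all invertible primes. Passing to the part of a number supported on
  a fixed set of primes is multiplicative and fixes \<open>1\<close>, so it preserves the divisibility
  \<open>c \<sigma>' c \<sigma>'' dvd c (\<sigma>' \<union> \<sigma>'')\<close> and the normalisation on sets of at most one element
  (\<open>divisible_coeffs_prime_part\<close>).\<close>

definition prime_part :: "nat set \<Rightarrow> nat \<Rightarrow> nat" where
  "prime_part P n = prod_mset (filter_mset (\<lambda>p. p \<in> P) (prime_factorization n))"

lemma prime_part_pos: "prime_part P n > 0"
proof -
  have "0 \<notin># filter_mset (\<lambda>p. p \<in> P) (prime_factorization n)"
    using in_prime_factors_imp_prime[of 0 n] by auto
  then have "prime_part P n \<noteq> 0" unfolding prime_part_def prod_mset_zero_iff .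
  then show ?thesis by simp
qed

lemma prime_part_1: "prime_part P 1 = 1"
  by (simp add: prime_part_def)

lemma prime_part_mult:
  "a > 0 \<Longrightarrow> b > 0 \<Longrightarrow> prime_part P (a * b) = prime_part P a * prime_part P b"
  by (simp add: prime_part_def prime_factorization_mult)

lemma prime_part_dvd: "a dvd b \<Longrightarrow> b > 0 \<Longrightarrow> prime_part P a dvd prime_part P b"
  by (auto simp: prime_part_mult elim!: dvdE)

lemma prime_part_decomp: "n > 0 \<Longrightarrow> n = prime_part P n * prime_part (- P) n"
proof -
  assume "n > 0"
  have "prime_part P n * prime_part (- P) n = prod_mset (prime_factorization n)"
    unfolding prime_part_def Compl_iff by (simp flip: multiset_partition prod_mset.union)
  with \<open>n > 0\<close> show ?thesis by (simp add: prod_mset_prime_factorization_nat)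
qed

lemma coprime_prime_part:
  assumes "Factorial_Ring.prime q" "q \<notin> P"
  shows "coprime (prime_part P n) q"
proof -
  have "\<not> q dvd prime_part P n"
  proof
    assume "q dvd prime_part P n"
    then have "q \<in># filter_mset (\<lambda>p. p \<in> P) (prime_factorization n)"
      unfolding prime_part_def using assms(1)
      by (subst (asm) prime_dvd_prod_mset_primes_iff) auto
    with assms(2) show False by simp
  qed
  with assms(1) show ?thesis using prime_imp_coprime coprime_commute by metis
qed

lemma divisible_coeffs_prime_part:
  assumes "divisible_coeffs m c"
  shows "divisible_coeffs m (\<lambda>\<sigma>. prime_part P (c \<sigma>))"
proof -
  have pos: "c \<sigma> > 0" if "\<sigma> \<subseteq> {1..m}" for \<sigma>
    using assms that by (auto simp: divisible_coeffs_def Suc_le_eq)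
  have "prime_part P (c \<sigma>') * prime_part P (c \<sigma>'') dvd prime_part P (c (\<sigma>' \<union> \<sigma>''))"
    if "\<sigma>' \<union> \<sigma>'' \<subseteq> {1..m}" "\<sigma>' \<inter> \<sigma>'' = {}" for \<sigma>' \<sigma>''
  proof -
    have "c \<sigma>' * c \<sigma>'' dvd c (\<sigma>' \<union> \<sigma>'')"
      using assms that unfolding divisible_coeffs_def by blast
    from prime_part_dvd[OF this pos[OF that(1)]] show ?thesis
      using pos that(1) by (simp add: prime_part_mult)
  qed
  then show ?thesis
    using assms prime_part_pos prime_part_1 unfolding divisible_coeffs_def
    by (metis One_nat_def Suc_leI)
qed

lemma Units_ring_of_inverse: "x \<in> Units (ring_of R) \<Longrightarrow> inverse x \<in> R"
  by (auto simp: Units_def rat_ring_def dest: inverse_unique)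

text \<open>Removing the invertible primes divides by a product of units, so the ratio of the new number
  to the old one lies in \<open>R\<close> together with its inverse.\<close>

lemma unit_ratio_prime_part:
  assumes R: "subring R rat_ring" and P: "\<And>p. p \<in> P \<Longrightarrow> of_nat p \<in> Units (ring_of R)"
    and n: "n > 0"
  shows "of_nat (prime_part (- P) n) / of_nat n \<in> R" "of_nat n / of_nat (prime_part (- P) n) \<in> R"
proof -
  note RC = subring_rat_closed[OF R]
  have nat: "of_nat k \<in> R" for k by (induction k) (auto intro: RC)
  have "inverse (of_nat (prod_mset (filter_mset (\<lambda>p. p \<in> P) M))) \<in> R" for M
    by (induction M) (auto simp: RC intro: RC(4) Units_ring_of_inverse P)
  then have inv: "inverse (of_nat (prime_part P n)) \<in> R" by (simp add: prime_part_def)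
  have eq: "(of_nat n :: rat) = of_nat (prime_part P n) * of_nat (prime_part (- P) n)"
    by (subst prime_part_decomp[OF n, of P]) simp
  show "of_nat (prime_part (- P) n) / of_nat n \<in> R"
    using inv prime_part_pos[of "- P" n] by (simp add: eq field_simps)
  show "of_nat n / of_nat (prime_part (- P) n) \<in> R"
    using nat prime_part_pos[of "- P" n] by (simp add: eq)
qed

text \<open>The isomorphism fixes each \<open>a\<^sub>i\<close> and hence takes \<open>c \<sigma> a\<^sub>\<sigma> = \<Prod>\<^sub>i\<^sub>\<in>\<^sub>\<sigma> a\<^sub>i\<close> to \<open>c' \<sigma> a'\<^sub>\<sigma>\<close>; that forces
  \<open>a\<^sub>\<sigma> \<mapsto> (c' \<sigma> / c \<sigma>) a'\<^sub>\<sigma>\<close>. This map is multiplicative because the structure constants are a sign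
  times \<open>c (\<sigma> \<union> \<tau>) / (c \<sigma> * c \<tau>)\<close>, a multiplicative coboundary of \<open>c\<close>.\<close>

lemma coeff_algebra_iso_of_unit_ratios:
  assumes R: "subring R rat_ring"
    and pos: "\<And>\<sigma>. \<sigma> \<subseteq> {1..m} \<Longrightarrow> c \<sigma> > 0" "\<And>\<sigma>. \<sigma> \<subseteq> {1..m} \<Longrightarrow> c' \<sigma> > 0"
    and ratio: "\<And>\<sigma>. \<sigma> \<subseteq> {1..m} \<Longrightarrow> of_nat (c' \<sigma>) / of_nat (c \<sigma>) \<in> R"
      "\<And>\<sigma>. \<sigma> \<subseteq> {1..m} \<Longrightarrow> of_nat (c \<sigma>) / of_nat (c' \<sigma>) \<in> R"
    and empty: "c {} = c' {}"
  shows "graded_algebra_iso (ring_of R)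
    (coeff_algebra R m d c) (coeff_piece R m d) (coeff_algebra R m d c') (coeff_piece R m d)"
proof -
  note RC = subring_rat_closed[OF R]
  let ?A = "coeff_algebra R m d c" and ?B = "coeff_algebra R m d c'"
  define rescale where
    "rescale a b x = (\<lambda>\<sigma>. of_nat (b \<sigma>) / of_nat (a \<sigma>) * x \<sigma> :: rat)"
    for a b :: "nat set \<Rightarrow> nat" and x
  let ?C = "{x. (\<forall>\<sigma>. x \<sigma> \<in> R) \<and> (\<forall>\<sigma>. x \<sigma> \<noteq> 0 \<longrightarrow> \<sigma> \<subseteq> {1..m})}"
  have carrier: "carrier ?A = ?C" "carrier ?B = ?C" by (simp_all add: coeff_algebra_def)
  have piece_sub: "coeff_piece R m d n \<subseteq> ?C" for n by (auto simp: coeff_piece_def)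
  have rescale_closed: "rescale a b x \<in> ?C"
    if x: "x \<in> ?C" and ab: "\<And>\<sigma>. \<sigma> \<subseteq> {1..m} \<Longrightarrow> of_nat (b \<sigma>) / of_nat (a \<sigma>) \<in> R" for a b x
  proof -
    have "rescale a b x \<sigma> \<in> R" for \<sigma>
    proof (cases "x \<sigma> = 0")
      case False
      with x have "\<sigma> \<subseteq> {1..m}" by auto
      then show ?thesis
        unfolding rescale_def using x by (intro RC(4) ab) auto
    qed (simp add: rescale_def RC)
    with x show ?thesis by (simp add: rescale_def)
  qed
  have closed: "rescale c c' x \<in> ?C" "rescale c' c x \<in> ?C" if "x \<in> ?C" for x
    by (rule rescale_closed[OF that]; erule ratio)+
  have piece: "rescale c c' x \<in> coeff_piece R m d n" "rescale c' c x \<in> coeff_piece R m d n"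
    if x: "x \<in> coeff_piece R m d n" for x n
  proof -
    have "x \<in> ?C" using x piece_sub by blast
    note closed[OF this]
    then show "rescale c c' x \<in> coeff_piece R m d n" "rescale c' c x \<in> coeff_piece R m d n"
      using x unfolding coeff_piece_def by (simp_all add: rescale_def)
  qed
  have cancel: "rescale a b (rescale b a x) = x"
    if x: "x \<in> ?C" and ab: "\<And>\<sigma>. \<sigma> \<subseteq> {1..m} \<Longrightarrow> a \<sigma> > 0 \<and> b \<sigma> > 0" for a b x
  proof
    fix \<sigma>
    show "rescale a b (rescale b a x) \<sigma> = x \<sigma>"
    proof (cases "x \<sigma> = 0")
      case False
      with x have "\<sigma> \<subseteq> {1..m}" by auto
      from ab[OF this] show ?thesis by (simp add: rescale_def)
    qed (simp add: rescale_def)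
  qed
  have inverse: "rescale c' c (rescale c c' x) = x" "rescale c c' (rescale c' c x) = x"
    if "x \<in> ?C" for x
    by (rule cancel[OF that]; simp add: pos)+
  have mult: "rescale c c' (x \<otimes>\<^bsub>?A\<^esub> y) = rescale c c' x \<otimes>\<^bsub>?B\<^esub> rescale c c' y"
    if x: "x \<in> ?C" and y: "y \<in> ?C" for x y
  proof
    fix \<rho>
    \<comment> \<open>The two products already agree term by term. A term with \<open>\<rho>\<close> not inside \<open>{1..m}\<close>, where
      the ratios are meaningless, vanishes because one of its two arguments is not inside either.\<close>
    have "of_nat (c' \<rho>) / of_nat (c \<rho>) *
        (s * (of_nat (c \<rho>) / (of_nat (c \<sigma>) * of_nat (c (\<rho> - \<sigma>)))) * (x \<sigma> * y (\<rho> - \<sigma>))) =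
      s * (of_nat (c' \<rho>) / (of_nat (c' \<sigma>) * of_nat (c' (\<rho> - \<sigma>)))) *
        (rescale c c' x \<sigma> * rescale c c' y (\<rho> - \<sigma>))"
      if "\<sigma> \<subseteq> \<rho>" for s \<sigma>
    proof (cases "x \<sigma> = 0 \<or> y (\<rho> - \<sigma>) = 0")
      case False
      then have "\<sigma> \<subseteq> {1..m}" "\<rho> - \<sigma> \<subseteq> {1..m}" using x y by auto
      moreover from this have "\<rho> \<subseteq> {1..m}" by blast
      ultimately show ?thesis
        using pos[of \<sigma>] pos[of "\<rho> - \<sigma>"] pos[of \<rho>] by (simp add: rescale_def)
    qed (auto simp: rescale_def)
    then show "rescale c c' (x \<otimes>\<^bsub>?A\<^esub> y) \<rho> = (rescale c c' x \<otimes>\<^bsub>?B\<^esub> rescale c c' y) \<rho>"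
      unfolding rescale_def[of c c' "x \<otimes>\<^bsub>?A\<^esub> y"]
      by (simp add: coeff_algebra_def sum_distrib_left)
  qed
  have one: "rescale c c' \<one>\<^bsub>?A\<^esub> = \<one>\<^bsub>?B\<^esub>"
    using empty pos(2)[of "{}"] by (auto simp: rescale_def coeff_algebra_def gen_def fun_eq_iff)
  have add: "rescale c c' (x \<oplus>\<^bsub>?A\<^esub> y) = rescale c c' x \<oplus>\<^bsub>?B\<^esub> rescale c c' y" for x y
    by (simp add: rescale_def coeff_algebra_def fun_eq_iff distrib_left)
  have "rescale c c' \<in> ring_hom ?A ?B"
    by (rule ring_hom_memI) (simp_all only: carrier closed mult add one)
  moreover have "bij_betw (rescale c c') (carrier ?A) (carrier ?B)"
    unfolding carrier
    by (rule bij_betwI[where g = "rescale c' c"]) (use closed inverse in \<open>auto simp del: mem_Collect_eq\<close>)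
  moreover have "rescale c c' ` coeff_piece R m d n = coeff_piece R m d n" for n
  proof (intro antisym subsetI)
    fix x assume x: "x \<in> coeff_piece R m d n"
    then have "x = rescale c c' (rescale c' c x)"
      using piece_sub by (intro inverse(2)[symmetric]) (rule subsetD)
    then show "x \<in> rescale c c' ` coeff_piece R m d n"
      using piece(2)[OF x] by (rule image_eqI)
  qed (auto intro: piece(1))
  moreover have "rescale c c' (r \<odot>\<^bsub>?A\<^esub> x) = r \<odot>\<^bsub>?B\<^esub> rescale c c' x" for r x
    by (simp add: rescale_def coeff_algebra_def fun_eq_iff)
  ultimately show ?thesis
    unfolding graded_algebra_iso_def ring_iso_def
    by (intro bexI[of _ "rescale c c'"] CollectI conjI ballI allI)
qed

theorem lemma8p3:
  fixes R :: "rat set" and m :: nat and d :: "nat \<Rightarrow> nat" and c :: "nat set \<Rightarrow> nat"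
  assumes "subring R rat_ring"
    and "\<forall>i\<in>{1..m}. 1 \<le> d i"
    and "\<forall>\<sigma>. \<sigma> \<subseteq> {1..m} \<longrightarrow> 1 \<le> c \<sigma>"
    and "c {} = 1" and "\<forall>i\<in>{1..m}. c {i} = 1"
    and "\<forall>\<sigma> \<sigma>' \<sigma>''. \<sigma> \<subseteq> {1..m} \<and> \<sigma> = \<sigma>' \<union> \<sigma>'' \<and> \<sigma>' \<inter> \<sigma>'' = {} \<longrightarrow> c \<sigma>' * c \<sigma>'' dvd c \<sigma>"
  shows "\<exists>c'. coefficient_sequence R m c' \<and>
           graded_algebra_iso (ring_of R)
             (coeff_algebra R m d c) (coeff_piece R m d)
             (coeff_algebra R m d c') (coeff_piece R m d)"
proof -
  have c: "divisible_coeffs m c" using assms(3-6) by (simp add: divisible_coeffs_def)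
  have pos: "c \<sigma> > 0" if "\<sigma> \<subseteq> {1..m}" for \<sigma>
    using assms(3) that by (simp add: Suc_le_eq)
  define P where "P = {p. of_nat p \<in> Units (ring_of R)}"
  define c' where "c' \<sigma> = prime_part (- P) (c \<sigma>)" for \<sigma>
  have "divisible_coeffs m c'"
    unfolding c'_def by (rule divisible_coeffs_prime_part[OF c])
  then have "coefficient_sequence R m c'"
    by (auto simp: coefficient_sequence_def c'_def P_def intro!: coprime_prime_part)
  moreover have "graded_algebra_iso (ring_of R)
      (coeff_algebra R m d c) (coeff_piece R m d) (coeff_algebra R m d c') (coeff_piece R m d)"
  proof (rule coeff_algebra_iso_of_unit_ratios[OF assms(1) pos])
    show "c' \<sigma> > 0" for \<sigma> by (simp add: c'_def prime_part_pos)
    show "c {} = c' {}" using assms(4) prime_part_1 by (simp add: c'_def)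
    show "of_nat (c' \<sigma>) / of_nat (c \<sigma>) \<in> R" "of_nat (c \<sigma>) / of_nat (c' \<sigma>) \<in> R"
      if "\<sigma> \<subseteq> {1..m}" for \<sigma>
      unfolding c'_def using unit_ratio_prime_part[OF assms(1) _ pos[OF that], of P]
      by (simp_all add: P_def)
  qed auto
  ultimately show ?thesis by blast
qed

end
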